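(* Let $G$ be a finite nilpotent group. If $|G| = m_1 \cdots m_k$, where $m_1, \ldots, m_k$ are integers greater than $1$ and $k \geq 3$, then there exist subsets $A_1, \ldots, A_k$ of $G$ which form a complete factorization of $G$ and satisfy $|A_i| = m_i$ for all $i = 1, 2, \ldots, k$.
   Context: Subsets $A_1, \ldots, A_k$ of a group $G$ (taken in this order) form a complete factorization of $G$ if they are pairwise disjoint and each element $g \in G$ is uniquely represented as $g = a_1 a_2 \cdots a_k$ with $a_i \in A_i$ for $i = 1, \ldots, k$. Here $|X|$ denotes the number of elements of a set $X$. *)

theory Defs
  imports "HOL-Algebra.Algebra"
begin

definition commutator_subgroup ::
  "('a, 'b) monoid_scheme \<Rightarrow> 'a set \<Rightarrow> 'a set \<Rightarrow> 'a set" where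
  "commutator_subgroup G H K =
     generate G {h \<otimes>\<^bsub>G\<^esub> k \<otimes>\<^bsub>G\<^esub> inv\<^bsub>G\<^esub> h \<otimes>\<^bsub>G\<^esub> inv\<^bsub>G\<^esub> k | h k. h \<in> H \<and> k \<in> K}"

(* Indexed from 0: the term with index 0 is the whole group. *)
primrec lower_central_series :: "('a, 'b) monoid_scheme \<Rightarrow> nat \<Rightarrow> 'a set" where
  "lower_central_series G 0 = carrier G"
| "lower_central_series G (Suc n) =
     commutator_subgroup G (carrier G) (lower_central_series G n)"

definition nilpotent :: "('a, 'b) monoid_scheme \<Rightarrow> bool" where
  "nilpotent G \<longleftrightarrow> (\<exists>n. lower_central_series G n = {\<one>\<^bsub>G\<^esub>})"

definition list_mult :: "('a, 'b) monoid_scheme \<Rightarrow> 'a list \<Rightarrow> 'a" where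
  "list_mult G xs = foldr (\<lambda>x y. x \<otimes>\<^bsub>G\<^esub> y) xs \<one>\<^bsub>G\<^esub>"

(* listset [A1, ..., Ak] is the set of lists [a1, ..., ak] with each ai in Ai.
   Disjointness is required between positions, so a nonempty set cannot be listed twice. *)
definition complete_factorization :: "('a, 'b) monoid_scheme \<Rightarrow> 'a set list \<Rightarrow> bool" where
  "complete_factorization G As \<longleftrightarrow>
     (\<forall>i<length As. As ! i \<subseteq> carrier G) \<and>
     (\<forall>i<length As. \<forall>j<length As. i \<noteq> j \<longrightarrow> As ! i \<inter> As ! j = {}) \<and>
     (\<forall>g\<in>carrier G. \<exists>!as. as \<in> listset As \<and> list_mult G as = g)"

end

theory Submission
  imports Defs
begin

text \<open>
  The proof first finds a factorization with the prescribed sizes and then makes its factors disjoint.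

  A finite nilpotent group has a chain of normal subgroups from the trivial subgroup to the whole group
  in which each step is a central extension of prime index
  (\<open>nilpotent_central_mod_prime\<close>, \<open>central_extension\<close>). The prime of each step divides one of the sizes
  that are still to be realized, and the representatives of the step can be multiplied into the factor
  at that place, since they commute with everything modulo the smaller subgroup (\<open>nilpotent_cover\<close>).
  Once the product of the factors is the whole group, counting shows that the sizes are exact and that
  representations are unique (\<open>nilpotent_factorization\<close>, \<open>complete_factorizationI\<close>).

  A factorization stays one when \<open>A\<^sub>i\<close> is replaced by \<open>A\<^sub>i t\<close> and the next factor by its translate by the
  inverse of \<open>t\<close> on the left. Choosing the translations one after the other, the factor of size \<open>m\<^sub>j\<close>
  must avoid the earlier ones, and at most \<open>(m\<^sub>1 + \<dots> + m\<^sub>j\<^sub>-\<^sub>1) m\<^sub>j\<close> translations are excluded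
  (\<open>disjoint_translates\<close>). For at least three sizes this is less than the order of the group, except at
  the end of a list \<open>2, 2, m\<close> (\<open>sum_take_mult_less_prod_list\<close>). If \<open>m > 2\<close>, choosing the first factor last
  restores the inequality (\<open>two_two_complete_factorization\<close>). If \<open>m = 2\<close>, no order of choices does, and a
  central element of order \<open>2\<close> in the group of order \<open>8\<close> gives the factors explicitly
  (\<open>order_eight_complete_factorization\<close>).
\<close>

section \<open>Products and sums of lists of natural numbers\<close>

lemma prod_list_mono_nat:
  fixes xs ys :: "nat list"
  shows "list_all2 (\<le>) xs ys \<Longrightarrow> prod_list xs \<le> prod_list ys"
  by (induction rule: list_all2_induct) (auto intro: mult_le_mono)

text \<open>Bounding every factor from above and the product from below leaves no slack. This lets the
  construction of a factorization track upper bounds on the sizes only.\<close>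
lemma list_eq_if_prod_list_ge:
  fixes xs ys :: "nat list"
  shows "list_all2 (\<le>) xs ys \<Longrightarrow> prod_list ys \<le> prod_list xs \<Longrightarrow> 0 < prod_list ys \<Longrightarrow> xs = ys"
proof (induction rule: list_all2_induct)
  case (Cons x xs y ys)
  have le: "prod_list xs \<le> prod_list ys" by (rule prod_list_mono_nat[OF Cons(2)])
  have pos: "0 < y" "0 < prod_list ys" using Cons.prems by auto
  have "x = y"
  proof (rule ccontr)
    assume "x \<noteq> y"
    then have "x * prod_list ys < y * prod_list ys" using Cons.hyps(1) pos by simp
    also have "y * prod_list ys \<le> x * prod_list xs" using Cons.prems by simp
    also have "\<dots> \<le> x * prod_list ys" using le by simp
    finally show False by simp
  qed
  then show ?case using Cons pos by simp
qed simp

lemma prime_dvd_prod_list: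
  fixes ms :: "nat list"
  assumes "Factorial_Ring.prime q" 
  shows "q dvd prod_list ms \<Longrightarrow> \<exists>m\<in>set ms. q dvd m"
  by (induction ms) (use assms in \<open>auto simp: prime_dvd_mult_iff\<close>)

text \<open>Both parts iterate \<open>a + b \<le> a * b\<close> for \<open>a, b \<ge> 2\<close>, an equality only for \<open>a = b = 2\<close>.\<close>
lemma sum_list_less_prod_list:
  fixes ms :: "nat list"
  shows "\<forall>m\<in>set ms. 1 < m \<Longrightarrow> 2 \<le> length ms \<Longrightarrow> ms \<noteq> [2, 2] \<Longrightarrow> sum_list ms < prod_list ms"
    and "\<forall>m\<in>set ms. 1 < m \<Longrightarrow> ms \<noteq> [] \<Longrightarrow> sum_list ms \<le> prod_list ms"
proof -
  have two: "a + b \<le> a * b \<and> (\<not> (a = 2 \<and> b = 2) \<longrightarrow> a + b < a * b)" if "1 < a" "1 < b" for a b :: nat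
  proof -
    obtain c d where cd: "a = c + 2" "b = d + 2" using \<open>1 < a\<close> \<open>1 < b\<close> by (metis Suc_1 Suc_leI add.commute le_Suc_ex)
    show ?thesis unfolding cd by (simp add: algebra_simps)
  qed
  have le: "sum_list ms \<le> prod_list ms \<and> 1 < prod_list ms" if "\<forall>m\<in>set ms. 1 < m" "ms \<noteq> []" for ms :: "nat list"
    using that
  proof (induction ms)
    case (Cons m ms)
    show ?case
    proof (cases "ms = []")
      case False
      with Cons have "sum_list ms \<le> prod_list ms" "1 < prod_list ms" "1 < m" by auto
      with two[of m "prod_list ms"] show ?thesis
        by (auto intro: less_trans[OF _ le_less_trans[of _ "m + prod_list ms"]])
    qed (use Cons in auto)
  qed simp
  show "\<forall>m\<in>set ms. 1 < m \<Longrightarrow> ms \<noteq> [] \<Longrightarrow> sum_list ms \<le> prod_list ms"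
    using le by blast
  assume a: "\<forall>m\<in>set ms. 1 < m" and l: "2 \<le> length ms" and n: "ms \<noteq> [2, 2]"
  obtain m ms' where ms: "ms = m # ms'" using l by (cases ms) auto
  have m: "1 < m" and ms': "\<forall>m\<in>set ms'. 1 < m" "ms' \<noteq> []" using a l by (auto simp: ms)
  show "sum_list ms < prod_list ms"
  proof (cases "m = 2 \<and> prod_list ms' = 2")
    case False
    then show ?thesis using two[OF m, of "prod_list ms'"] le[OF ms'] by (simp add: ms)
  next
    case True
    obtain m2 ms2 where ms2: "ms' = m2 # ms2" using ms' by (cases ms') auto
    have "ms2 \<noteq> []" using n True by (auto simp: ms ms2)
    then have "1 < prod_list ms2" "1 < m2" using le[of ms2] ms' by (auto simp: ms2)
    then have "2 < prod_list ms'" using two[of m2 "prod_list ms2"] by (simp add: ms2)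
    then show ?thesis using True by simp
  qed
qed

text \<open>The bound that leaves room for translating the factor at position \<open>j\<close> away from all earlier ones.
  If a later factor exists, it supplies a spare factor of at least \<open>2\<close>. At the last position the
  strictness must come from comparing the sum and the product of the earlier entries, and these agree
  for the entries \<open>2, 2\<close>.\<close>
lemma sum_take_mult_less_prod_list:
  fixes ms :: "nat list"
  assumes gt: "\<forall>m\<in>set ms. 1 < m" and len: "3 \<le> length ms"
    and no: "\<not> (\<exists>m. ms = [2, 2, m])" and j: "j < length ms"
  shows "sum_list (take j ms) * ms ! j < prod_list ms"
proof -
  let ?R = "drop (Suc j) ms"
  have "prod_list ms = prod_list (take j ms @ ms ! j # ?R)"
    using id_take_nth_drop[OF j] by (rule arg_cong)
  then have p: "prod_list ms = prod_list (take j ms) * ms ! j * prod_list ?R" by simp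
  have pos: "prod_list xs > 0" if "set xs \<subseteq> set ms" for xs
  proof -
    have "0 \<notin> set xs" using that gt by fastforce
    then show ?thesis by (metis gr0I prod_list_zero_iff)
  qed
  have mj: "ms ! j > 0" using gt j by (metis nth_mem order_less_trans zero_less_one)
  have all: "\<forall>m\<in>set (take j ms). 1 < m" using gt by (meson in_set_takeD)
  consider "j = 0" | "j > 0" "Suc j < length ms" | "Suc j = length ms" using j by linarith
  then show ?thesis
  proof cases
    case 1
    then show ?thesis using pos[of ms] by simp
  next
    case 2
    then have ne: "take j ms \<noteq> []" using j by auto
    have le: "sum_list (take j ms) \<le> prod_list (take j ms)"
      by (rule sum_list_less_prod_list(2)[OF all ne])
    have "\<forall>m\<in>set ?R. 1 < m" using gt by (meson in_set_dropD)
    then have R: "1 < prod_list ?R"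
      using 2 pos[of "tl ?R"] set_drop_subset[of "Suc j" ms] 
      by (cases ?R) (auto intro: less_le_trans)
    have P: "prod_list (take j ms) * ms ! j > 0" using mj pos[of "take j ms"] by (simp add: set_take_subset)
    have "sum_list (take j ms) * ms ! j \<le> prod_list (take j ms) * ms ! j" using le by simp
    also have "\<dots> < prod_list (take j ms) * ms ! j * prod_list ?R" using P R by simp
    finally show ?thesis using p by simp
  next
    case 3
    have "take j ms \<noteq> [2, 2]"
    proof
      assume t: "take j ms = [2, 2]"
      then have "j = 2" using 3 len by (auto dest: arg_cong[of _ _ length])
      then have "ms = [2, 2, ms ! 2]" using id_take_nth_drop[OF j] t 3 by simp
      then show False using no by blast
    qed
    then have "sum_list (take j ms) < prod_list (take j ms)"
      using 3 len by (intro sum_list_less_prod_list(1) all) auto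
    then show ?thesis using mj 3 by (simp add: p)
  qed
qed

section \<open>Products of subsets of a group\<close>

text \<open>The last factor is a parameter so that products can be taken modulo a normal subgroup \<open>T\<close>; the
  plain product is the case \<open>T = {\<one>}\<close>.\<close>
definition set_prod :: "('a, 'b) monoid_scheme \<Rightarrow> 'a set list \<Rightarrow> 'a set \<Rightarrow> 'a set" where
  "set_prod G As T = foldr (\<lambda>A B. A <#>\<^bsub>G\<^esub> B) As T"

lemma set_prod_simps [simp]:
  "set_prod G [] T = T" "set_prod G (A # As) T = A <#>\<^bsub>G\<^esub> set_prod G As T"
  by (simp_all add: set_prod_def)

lemma set_prod_append: "set_prod G (As @ Bs) T = set_prod G As (set_prod G Bs T)"
  by (simp add: set_prod_def)

lemma listset_finite_card:
  "\<forall>A\<in>set As. finite A \<Longrightarrow> finite (listset As) \<and> card (listset As) = prod_list (map card As)"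
proof (induction As)
  case (Cons A As)
  have "listset (A # As) = (\<lambda>(a, as). a # as) ` (A \<times> listset As)"
    by (auto simp: set_Cons_def)
  moreover have "inj_on (\<lambda>(a, as). a # as) (A \<times> listset As)" by (auto simp: inj_on_def)
  ultimately show ?case using Cons by (simp add: card_image card_cartesian_product)
qed simp

context group
begin

lemma set_prod_closed:
  "\<forall>A\<in>set As. A \<subseteq> carrier G \<Longrightarrow> T \<subseteq> carrier G \<Longrightarrow> set_prod G As T \<subseteq> carrier G"
  by (induction As) (auto simp: setmult_subset_G)

lemma list_mult_image_listset: "list_mult G ` listset As = set_prod G As {\<one>}"
proof (induction As)
  case (Cons A As)
  have "list_mult G ` listset (A # As) = A <#> list_mult G ` listset As"
    by (force simp: set_Cons_def set_mult_def list_mult_def image_iff)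
  then show ?case using Cons by simp
qed (simp add: list_mult_def)

lemma set_mult_one:
  assumes "A \<subseteq> carrier G"
  shows "{\<one>} <#> A = A" "A <#> {\<one>} = A"
  using assms lcos_mult_one coset_mult_one l_coset_eq_set_mult r_coset_eq_set_mult by metis+

lemma card_set_mult_le:
  assumes "finite A" "finite B"
  shows "card (A <#> B) \<le> card A * card B"
proof -
  have "A <#> B = (\<lambda>(a, b). a \<otimes> b) ` (A \<times> B)" by (auto simp: set_mult_def)
  then show ?thesis using assms by (metis card_image_le card_cartesian_product finite_cartesian_product)
qed

lemma card_set_prod_le:
  assumes "\<forall>A\<in>set As. finite A" "finite T"
  shows "finite (set_prod G As T) \<and> card (set_prod G As T) \<le> prod_list (map card As) * card T"
  using assms(1)
proof (induction As)
  case (Cons A As)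
  then have IH: "finite (set_prod G As T)" "card (set_prod G As T) \<le> prod_list (map card As) * card T"
    by auto
  have "card (A <#> set_prod G As T) \<le> card A * card (set_prod G As T)"
    using Cons IH by (intro card_set_mult_le) auto
  also have "\<dots> \<le> card A * (prod_list (map card As) * card T)" using IH by simp
  finally have "card (A <#> set_prod G As T) \<le> card A * (prod_list (map card As) * card T)" .
  moreover have "finite (A <#> set_prod G As T)" using Cons IH by (auto simp: set_mult_def)
  ultimately show ?case by (simp add: mult.assoc)
qed (use assms in simp)

text \<open>The number of tuples equals the number of group elements, so a multiplication map onto the group
  is also injective: uniqueness of representations follows from existence.\<close>
lemma complete_factorizationI:
  assumes fin: "finite (carrier G)" and As: "\<forall>A\<in>set As. A \<subseteq> carrier G"
    and disj: "sorted_wrt (\<lambda>A B. A \<inter> B = {}) As"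
    and prod: "set_prod G As {\<one>} = carrier G"
    and card: "prod_list (map card As) = order G"
  shows "complete_factorization G As"
proof -
  have f: "\<forall>A\<in>set As. finite A" using As fin finite_subset by blast
  have im: "list_mult G ` listset As = carrier G"
    using prod by (simp add: list_mult_image_listset)
  have inj: "inj_on (list_mult G) (listset As)"
    using listset_finite_card[OF f] card im by (intro eq_card_imp_inj_on) (auto simp: order_def)
  have "\<exists>!as. as \<in> listset As \<and> list_mult G as = g" if "g \<in> carrier G" for g
    using that im inj by (metis (no_types, lifting) imageE inj_onD)
  moreover have "As ! i \<inter> As ! j = {}" if "i < length As" "j < length As" "i \<noteq> j" for i j
    using that sorted_wrt_nth_less[OF disj, of i j] sorted_wrt_nth_less[OF disj, of j i]
    by (cases i j rule: linorder_cases) auto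
  ultimately show ?thesis using As by (simp add: complete_factorization_def)
qed

end

section \<open>Central extensions of prime index\<close>

text \<open>Centrality of the coset of \<open>x\<close> in the quotient by \<open>N\<close>, written with elements: an induction through
  quotient groups would change the type of the group at every step.\<close>
definition central_mod :: "('a, 'b) monoid_scheme \<Rightarrow> 'a set \<Rightarrow> 'a \<Rightarrow> bool" where
  "central_mod G N x \<longleftrightarrow>
     (\<forall>g\<in>carrier G. \<exists>n\<in>N. x \<otimes>\<^bsub>G\<^esub> g = g \<otimes>\<^bsub>G\<^esub> x \<otimes>\<^bsub>G\<^esub> n)"

context group
begin

lemma central_mod_pow:
  assumes N: "N \<lhd> G" and x: "x \<in> carrier G" and c: "central_mod G N x"
  shows "central_mod G N (x [^] (j::nat))"
proof (induction j)
  case 0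
  show ?case
    using normal_imp_subgroup[OF N] by (auto simp: central_mod_def intro!: bexI[of _ \<one>] subgroup.one_closed)
next
  case (Suc j)
  interpret normal N G by (rule N)
  show ?case
    unfolding central_mod_def
  proof
    fix g assume g: "g \<in> carrier G"
    obtain n where n: "n \<in> N" "x \<otimes> g = g \<otimes> x \<otimes> n" using c g by (auto simp: central_mod_def)
    obtain n' where n': "n' \<in> N" "x [^] j \<otimes> g = g \<otimes> x [^] j \<otimes> n'"
      using Suc g by (auto simp: central_mod_def)
    define n'' where "n'' = inv x \<otimes> n' \<otimes> x"
    have n'': "n'' \<in> N" using n' x by (simp add: n''_def inv_op_closed1)
    have *: "n' \<otimes> x = x \<otimes> n''"
      using n' x by (simp add: n''_def m_assoc[symmetric])
    have "x [^] Suc j \<otimes> g = x [^] j \<otimes> g \<otimes> x \<otimes> n"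
      using x g n by (simp add: m_assoc)
    also have "\<dots> = g \<otimes> x [^] j \<otimes> (n' \<otimes> x) \<otimes> n"
      using x g n n' by (simp add: m_assoc)
    also have "\<dots> = g \<otimes> x [^] Suc j \<otimes> (n'' \<otimes> n)"
      unfolding * using x g n n'' by (simp add: m_assoc)
    finally show "\<exists>n\<in>N. x [^] Suc j \<otimes> g = g \<otimes> x [^] Suc j \<otimes> n"
      using n n'' by blast
  qed
qed

text \<open>Take the last term of the lower central series that is not contained in \<open>N\<close>: its commutators with
  all of the group lie in \<open>N\<close>.\<close>
lemma nilpotent_central_mod:
  assumes nil: "nilpotent G" and N: "N \<lhd> G" and NG: "N \<noteq> carrier G"
  obtains x where "x \<in> carrier G" "x \<notin> N" "central_mod G N x"
proof -
  interpret normal N G by (rule N)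
  let ?L = "lower_central_series G"
  define n where "n = (LEAST n. ?L n \<subseteq> N)"
  obtain n0 where "?L n0 = {\<one>}" using nil by (auto simp: nilpotent_def)
  then have "?L n0 \<subseteq> N" by simp
  then have "\<exists>n. ?L n \<subseteq> N" by blast
  then have n: "?L n \<subseteq> N" unfolding n_def by (rule LeastI_ex)
  have "n \<noteq> 0" using n NG subset by auto
  then obtain k where k: "n = Suc k" by (cases n) auto
  then have "\<not> ?L k \<subseteq> N" using not_less_Least[of k "\<lambda>n. ?L n \<subseteq> N"] by (simp add: n_def)
  then obtain x where x: "x \<in> ?L k" "x \<notin> N" by auto
  have Lk: "?L k \<subseteq> carrier G"
  proof (induction k)
    case (Suc k)
    show ?case
      unfolding lower_central_series.simps commutator_subgroup_def
      by (rule generate_incl) (use Suc in auto)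
  qed simp
  have xG: "x \<in> carrier G" using x Lk by auto
  have "\<exists>n\<in>N. x \<otimes> g = g \<otimes> x \<otimes> n" if g: "g \<in> carrier G" for g
  proof -
    let ?c = "g \<otimes> x \<otimes> inv g \<otimes> inv x"
    have "?c \<in> ?L n"
      unfolding k lower_central_series.simps commutator_subgroup_def
      by (rule generate.incl) (use g x in blast)
    then have "?c \<in> N" using n by blast
    then have "inv (g \<otimes> x) \<otimes> inv ?c \<otimes> (g \<otimes> x) \<in> N"
      using g xG by (intro inv_op_closed1) auto
    moreover have "?c \<otimes> (x \<otimes> g) = g \<otimes> x"
    proof -
      have "inv x \<otimes> (x \<otimes> g) = g" using g xG by (simp add: m_assoc[symmetric])
      then show ?thesis using g xG by (simp add: m_assoc)
    qed
    then have "x \<otimes> g = inv ?c \<otimes> (g \<otimes> x)"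
      using g xG by (intro inv_solve_left[THEN iffD2]) auto
    then have "g \<otimes> x \<otimes> (inv (g \<otimes> x) \<otimes> inv ?c \<otimes> (g \<otimes> x)) = x \<otimes> g"
      using g xG by (simp add: m_assoc[symmetric] del: inv_mult_group)
    ultimately show ?thesis by metis
  qed
  then show thesis using that xG x by (auto simp: central_mod_def)
qed

text \<open>If \<open>d\<close> is the order of a central element \<open>y\<close> modulo \<open>N\<close> and \<open>q\<close> is a prime divisor of \<open>d\<close>, then
  \<open>y\<close> to the power \<open>d / q\<close> has order \<open>q\<close> modulo \<open>N\<close>.\<close>
lemma nilpotent_central_mod_prime:
  assumes fin: "finite (carrier G)" and nil: "nilpotent G" and N: "N \<lhd> G" and NG: "N \<noteq> carrier G"
  obtains x and q :: nat where "x \<in> carrier G" "x \<notin> N" "central_mod G N x" "Factorial_Ring.prime q" "x [^] q \<in> N"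
proof -
  interpret normal N G by (rule N)
  obtain y where y: "y \<in> carrier G" "y \<notin> N" "central_mod G N y"
    by (rule nilpotent_central_mod[OF nil N NG])
  define d where "d = (LEAST d::nat. d > 0 \<and> y [^] d \<in> N)"
  have "\<exists>d::nat. d > 0 \<and> y [^] d \<in> N"
    using fin y(1) one_closed by (metis pow_order_eq_1 order_gt_0_iff_finite)
  then have d: "d > 0" "y [^] d \<in> N"
    unfolding d_def by (rule LeastI2_ex; simp)+
  have "d \<noteq> 1" using d y by auto
  then obtain q where q: "Factorial_Ring.prime q" "q dvd d"
    using prime_factor_nat by blast
  then obtain e where e: "d = e * q" by (metis dvd_div_mult_self)
  have "e > 0" using d(1) unfolding e by simp
  moreover from this have "e < d" using prime_gt_1_nat[OF q(1)] unfolding e by simp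
  ultimately have "y [^] e \<notin> N"
    using not_less_Least[of e "\<lambda>d. d > 0 \<and> y [^] d \<in> N"] by (simp add: d_def)
  moreover have "(y [^] e) [^] q \<in> N" using d(2) y(1) unfolding e by (simp add: nat_pow_pow)
  ultimately show thesis
    using that[of "y [^] e" q] y q central_mod_pow[OF N y(1,3)] by simp
qed

text \<open>The powers of \<open>x\<close> below \<open>q\<close> represent, each exactly once, the cosets of \<open>N\<close> in the subgroup that
  \<open>x\<close> generates modulo \<open>N\<close>; as \<open>x\<close> is central modulo \<open>N\<close>, that subgroup is normal.\<close>
lemma central_extension:
  fixes q :: nat
  assumes fin: "finite (carrier G)" and N: "N \<lhd> G" and x: "x \<in> carrier G" "x \<notin> N"
    and c: "central_mod G N x" and q: "Factorial_Ring.prime q" and xq: "x [^] q \<in> N"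
  defines "M \<equiv> (\<lambda>j. x [^] j) ` {..<q} <#> N"
  shows "M \<lhd> G" and "card M = q * card N"
proof -
  interpret normal N G by (rule N)
  have q0: "q > 0" using q by (rule prime_gt_0_nat)
  have pow: "a [^] (k::nat) \<in> N" if "a \<in> N" for a k
    using that by (induction k) auto
  have M: "M = generate G {x} <#> N"
  proof
    show "M \<subseteq> generate G {x} <#> N"
      unfolding M_def generate_pow_on_finite_carrier[OF fin x(1)] by (intro mono_set_mult) auto
    show "generate G {x} <#> N \<subseteq> M"
    proof
      fix z assume "z \<in> generate G {x} <#> N"
      then obtain j :: nat and n where n: "n \<in> N" "z = x [^] j \<otimes> n"
        by (auto simp: set_mult_def generate_pow_on_finite_carrier[OF fin x(1)])
      have "x [^] j = x [^] (j mod q) \<otimes> (x [^] q) [^] (j div q)"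
        using x by (simp add: nat_pow_pow nat_pow_mult)
      moreover have "(x [^] q) [^] (j div q) \<in> N"
        by (rule pow[OF xq])
      ultimately have "z = x [^] (j mod q) \<otimes> ((x [^] q) [^] (j div q) \<otimes> n)"
        "(x [^] q) [^] (j div q) \<otimes> n \<in> N"
        using n x by (auto simp: m_assoc)
      then show "z \<in> M" using q0 unfolding M_def set_mult_def by auto
    qed
  qed
  have "subgroup M G"
    unfolding M using mult_norm_subgroup[OF N generate_is_subgroup[of "{x}"]] x 
      commut_normal[OF generate_is_subgroup[of "{x}"] N] by simp
  then show "M \<lhd> G"
  proof (rule normal_invI)
    fix g h assume g: "g \<in> carrier G" and "h \<in> M"
    then obtain j m where j: "j < q" and m: "m \<in> N" and h: "h = x [^] j \<otimes> m"
      by (auto simp: M_def set_mult_def)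
    obtain n where n: "n \<in> N" "x [^] j \<otimes> inv g = inv g \<otimes> x [^] j \<otimes> n"
      using central_mod_pow[OF N x(1) c, of j] g by (auto simp: central_mod_def)
    define m' where "m' = g \<otimes> m \<otimes> inv g"
    have m': "m' \<in> N" using m g by (simp add: m'_def inv_op_closed2)
    have *: "m \<otimes> inv g = inv g \<otimes> m'"
      using m g by (simp add: m'_def m_assoc[symmetric])
    have "g \<otimes> h \<otimes> inv g = g \<otimes> x [^] j \<otimes> (m \<otimes> inv g)"
      using g m x by (simp add: h m_assoc)
    also have "\<dots> = g \<otimes> (x [^] j \<otimes> inv g) \<otimes> m'"
      unfolding * using g m' x by (simp add: m_assoc)
    also have "\<dots> = x [^] j \<otimes> (n \<otimes> m')"
      unfolding n(2) using g m' n x by (simp add: m_assoc[symmetric])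
    finally show "g \<otimes> h \<otimes> inv g \<in> M"
      using j m' n(1) by (auto simp: M_def set_mult_def)
  qed
  have less: False if "i < j" "j < q" "n \<in> N" "m \<in> N" "x [^] i \<otimes> n = x [^] j \<otimes> m" for i j :: nat and n m
  proof -
    have "x [^] j = x [^] i \<otimes> x [^] (j - i)" using that x by (simp add: nat_pow_mult)
    with that x have "n = x [^] (j - i) \<otimes> m" by (simp add: m_assoc)
    then have "x [^] (j - i) = n \<otimes> inv m"
      using that x by (metis inv_solve_right mem_carrier nat_pow_closed)
    then have 1: "x [^] (j - i) \<in> N"
      using that by simp
    have "j - i > 0" "j - i < q" using that by simp_all
    then have "\<not> q dvd j - i" by (simp add: nat_dvd_not_less)
    \<comment> \<open>Two powers of \<open>x\<close> with coprime exponents lie in \<open>N\<close>, hence so does \<open>x\<close>.\<close>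
    then have "coprime (j - i) q"
      using q by (simp add: coprime_commute prime_imp_coprime)
    moreover have "j - i \<noteq> 0" using that by simp
    ultimately obtain u v where "(j - i) * u = q * v + 1"
      using bezout_nat[of "j - i" q] by (metis coprime_iff_gcd_eq_1)
    then have "(x [^] (j - i)) [^] u = (x [^] q) [^] v \<otimes> x"
      using x(1) by (simp add: nat_pow_pow)
    then have "x = inv ((x [^] q) [^] v) \<otimes> (x [^] (j - i)) [^] u"
      using x(1) by (metis inv_solve_left nat_pow_closed)
    then have "x \<in> N" using pow[OF 1, of u] pow[OF xq, of v] by (metis m_closed m_inv_closed)
    then show False using x(2) by contradiction
  qed
  have "inj_on (\<lambda>(j, n). x [^] j \<otimes> n) ({..<q} \<times> N)"
  proof (rule inj_onI, clarsimp)
    fix i j :: nat and n m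
    assume a: "i < q" "j < q" "n \<in> N" "m \<in> N" "x [^] i \<otimes> n = x [^] j \<otimes> m"
    have "i = j" using less[of i j n m] less[of j i m n] a by (metis linorder_less_linear)
    then show "i = j \<and> n = m" using a x by simp
  qed
  moreover have "M = (\<lambda>(j, n). x [^] j \<otimes> n) ` ({..<q} \<times> N)"
    by (auto simp: M_def set_mult_def)
  ultimately show "card M = q * card N" by (simp add: card_image card_cartesian_product)
qed

section \<open>Factorizations of nilpotent groups\<close>

lemma normal_set_mult_commute:
  assumes "N \<lhd> G" "A \<subseteq> carrier G"
  shows "N <#> A = A <#> N"
proof -
  have "N <#> A = (\<Union>a\<in>A. N #> a)" "A <#> N = (\<Union>a\<in>A. a <# N)"
    by (auto simp: set_mult_def r_coset_def l_coset_def)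
  moreover have "(\<Union>a\<in>A. N #> a) = (\<Union>a\<in>A. a <# N)"
    using assms(2) normal.coset_eq[OF assms(1)] by (intro SUP_cong) auto
  ultimately show ?thesis by simp
qed

lemma set_prod_normal_absorb:
  assumes N: "N \<lhd> G" and "\<forall>A\<in>set As. A \<subseteq> carrier G"
  shows "N <#> set_prod G As N = set_prod G As N"
  using assms(2)
proof (induction As)
  case Nil
  then show ?case using normal_imp_subgroup[OF N] subgroup_mult_id by simp
next
  case (Cons A As)
  have NG: "N \<subseteq> carrier G" using normal_imp_subgroup[OF N] by (rule subgroup.subset)
  have PG: "set_prod G As N \<subseteq> carrier G" using Cons NG by (intro set_prod_closed) auto
  have "N <#> (A <#> set_prod G As N) = A <#> (N <#> set_prod G As N)"
    using Cons.prems NG PG normal_set_mult_commute[OF N, of A] by (simp add: set_mult_assoc[symmetric])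
  then show ?case using Cons by simp
qed

text \<open>Moving \<open>x\<close> past \<open>a\<close> costs an element of \<open>N\<close>, which \<open>T\<close> absorbs.\<close>
lemma central_mod_set_commute:
  assumes N: "N \<lhd> G" and Y: "Y \<subseteq> carrier G" "\<forall>x\<in>Y. central_mod G N x"
    and A: "A \<subseteq> carrier G" and T: "T \<subseteq> carrier G" "N <#> T = T"
  shows "Y <#> (A <#> T) = A <#> (Y <#> T)"
proof -
  interpret normal N G by (rule N)
  have nt: "n \<otimes> t \<in> T" if "n \<in> N" "t \<in> T" for n t
    using T(2) that by (auto simp: set_mult_def)
  show ?thesis
  proof
    show "Y <#> (A <#> T) \<subseteq> A <#> (Y <#> T)"
    proof
      fix z assume "z \<in> Y <#> (A <#> T)"
      then obtain x a t where z: "x \<in> Y" "a \<in> A" "t \<in> T" "z = x \<otimes> (a \<otimes> t)"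
        by (auto simp: set_mult_def)
      moreover obtain n where n: "n \<in> N" "x \<otimes> a = a \<otimes> x \<otimes> n"
        using z(1,2) Y(2) A unfolding central_mod_def by blast
      have "z = a \<otimes> (x \<otimes> (n \<otimes> t))"
      proof -
        have c: "x \<in> carrier G" "a \<in> carrier G" "t \<in> carrier G" "n \<in> carrier G"
          using z(1-3) n(1) Y(1) A T(1) by auto
        have "z = (x \<otimes> a) \<otimes> t" using c z by (simp add: m_assoc)
        then show ?thesis unfolding n(2) using c by (simp add: m_assoc)
      qed
      then show "z \<in> A <#> (Y <#> T)"
        using z nt[OF n(1) z(3)] unfolding set_mult_def by blast
    qed
    show "A <#> (Y <#> T) \<subseteq> Y <#> (A <#> T)"
    proof
      fix z assume "z \<in> A <#> (Y <#> T)"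
      then obtain x a t where z: "x \<in> Y" "a \<in> A" "t \<in> T" "z = a \<otimes> (x \<otimes> t)"
        by (auto simp: set_mult_def)
      moreover obtain n where n: "n \<in> N" "x \<otimes> a = a \<otimes> x \<otimes> n"
        using z(1,2) Y(2) A unfolding central_mod_def by blast
      have "z = x \<otimes> (a \<otimes> (inv n \<otimes> t))"
      proof -
        have c: "x \<in> carrier G" "a \<in> carrier G" "t \<in> carrier G" "n \<in> carrier G"
          using z(1-3) n(1) Y(1) A T(1) by auto
        have "n \<otimes> (inv n \<otimes> t) = t" using c by (simp add: m_assoc[symmetric])
        then have "z = (a \<otimes> x \<otimes> n) \<otimes> (inv n \<otimes> t)" using c z by (simp add: m_assoc)
        then show ?thesis unfolding n(2)[symmetric] using c by (simp add: m_assoc)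
      qed
      then show "z \<in> Y <#> (A <#> T)"
        using z nt[OF m_inv_closed[OF n(1)] z(3)] unfolding set_mult_def by blast
    qed
  qed
qed

lemma set_prod_central_mod:
  assumes N: "N \<lhd> G" and Y: "Y \<subseteq> carrier G" "\<forall>x\<in>Y. central_mod G N x"
    and As: "\<forall>A\<in>set As. A \<subseteq> carrier G"
  shows "Y <#> set_prod G As N = set_prod G As (Y <#> N)"
  using As
proof (induction As)
  case (Cons A As)
  have NG: "N \<subseteq> carrier G" using normal_imp_subgroup[OF N] by (rule subgroup.subset)
  have "Y <#> (A <#> set_prod G As N) = A <#> (Y <#> set_prod G As N)"
    using Cons NG by (intro central_mod_set_commute[OF N Y] set_prod_closed set_prod_normal_absorb[OF N]) auto
  then show ?case using Cons by simp
qed simp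

text \<open>The factorization is built downwards along a chain of normal subgroups. From \<open>N\<close> pass to the
  central extension \<open>M\<close> by an element \<open>x\<close> of prime order \<open>q\<close> modulo \<open>N\<close>. Since \<open>q\<close> divides the index of
  \<open>N\<close>, it divides some size \<open>m\<close>. A product covering the group modulo \<open>M\<close> with \<open>m / q\<close> in place of \<open>m\<close>
  becomes one modulo \<open>N\<close> when the factor at that place is multiplied by the first \<open>q\<close> powers of \<open>x\<close>,
  because these powers can be moved to the end.\<close>
lemma nilpotent_cover:
  assumes fin: "finite (carrier G)" and nil: "nilpotent G"
  shows "N \<lhd> G \<Longrightarrow> prod_list ms * card N = order G \<Longrightarrow>
     \<exists>As. list_all2 (\<lambda>A m. A \<subseteq> carrier G \<and> card A \<le> m) As ms \<and> set_prod G As N = carrier G"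
proof (induction "prod_list ms" arbitrary: N ms rule: less_induct)
  case less
  note N = less.prems(1)
  interpret normal N G by (rule N)
  have finN: "finite N" using fin subset finite_subset by blast
  have "order G > 0" using fin by (simp add: order_gt_0_iff_finite)
  then have pos: "prod_list ms > 0" "card N > 0" using less.prems(2) by (metis gr0I mult_0 mult_0_right)+
  show ?case
  proof (cases "N = carrier G")
    case True
    have "set_prod G (replicate n {\<one>}) N = N" for n
      using subset by (induction n) (auto simp: set_mult_def)
    moreover have "m \<ge> 1" if "m \<in> set ms" for m
    proof -
      have "m \<noteq> 0" using that pos(1) by (metis less_irrefl prod_list_zero_iff)
      then show ?thesis by simp
    qed
    ultimately show ?thesis using True
      by (intro exI[of _ "replicate (length ms) {\<one>}"]) (auto simp: list_all2_conv_all_nth)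
  next
    case False
    obtain x and q :: nat where x: "x \<in> carrier G" "x \<notin> N" "central_mod G N x"
      and q: "Factorial_Ring.prime q" "x [^] q \<in> N"
      by (rule nilpotent_central_mod_prime[OF fin nil N False])
    define Y where "Y = (\<lambda>j. x [^] j) ` {..<q}"
    have Y: "Y \<subseteq> carrier G" "\<forall>x\<in>Y. central_mod G N x" "card Y \<le> q" "finite Y"
      using x central_mod_pow[OF N x(1,3)] card_image_le[of "{..<q}" "\<lambda>j. x [^] j"] by (auto simp: Y_def)
    have M: "Y <#> N \<lhd> G" "card (Y <#> N) = q * card N"
      using central_extension[OF fin N x q] by (simp_all add: Y_def)
    have "card (Y <#> N) dvd order G"
      using lagrange[OF normal_imp_subgroup[OF M(1)]] by (metis dvd_triv_right)
    then have "q dvd prod_list ms"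
      using pos unfolding M(2) less.prems(2)[symmetric] by simp
    then obtain m where "m \<in> set ms" "q dvd m" using prime_dvd_prod_list[OF q(1)] by blast
    then obtain ms1 ms2 m' where ms: "ms = ms1 @ (q * m') # ms2"
      by (metis dvdE split_list)
    let ?ms' = "ms1 @ m' # ms2"
    have p: "prod_list ms = q * prod_list ?ms'" by (simp add: ms)
    have "prod_list ?ms' < prod_list ms" using pos(1) prime_gt_1_nat[OF q(1)] unfolding p by simp
    moreover have "prod_list ?ms' * card (Y <#> N) = order G"
      using less.prems(2) unfolding p M(2) by (simp only: ac_simps)
    ultimately obtain As where As: "list_all2 (\<lambda>A m. A \<subseteq> carrier G \<and> card A \<le> m) As ?ms'"
      "set_prod G As (Y <#> N) = carrier G"
      using less.hyps M(1) by blast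
    then obtain As1 A As2 where As': "As = As1 @ A # As2" 
      "list_all2 (\<lambda>A m. A \<subseteq> carrier G \<and> card A \<le> m) As1 ms1"
      "A \<subseteq> carrier G" "card A \<le> m'"
      "list_all2 (\<lambda>A m. A \<subseteq> carrier G \<and> card A \<le> m) As2 ms2"
      by (auto simp: list_all2_append2 list_all2_Cons2 simp del: One_nat_def)
    have "card (A <#> Y) \<le> q * m'"
    proof -
      have "card (A <#> Y) \<le> card A * card Y"
        using As'(3) fin Y(4) finite_subset by (intro card_set_mult_le) auto
      also have "\<dots> \<le> m' * q" using As'(4) Y(3) by (rule mult_le_mono)
      finally show ?thesis by (simp add: mult.commute)
    qed
    then have "list_all2 (\<lambda>A m. A \<subseteq> carrier G \<and> card A \<le> m) (As1 @ (A <#> Y) # As2) ms"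
      using As' setmult_subset_G[OF As'(3) Y(1)] by (simp add: ms list_all2_appendI)
    moreover have "set_prod G (As1 @ (A <#> Y) # As2) N = carrier G"
    proof -
      have As2: "\<forall>A\<in>set As2. A \<subseteq> carrier G"
        using As'(5) by (induction rule: list_all2_induct) auto
      have "(A <#> Y) <#> set_prod G As2 N = A <#> (Y <#> set_prod G As2 N)"
        using As'(3) Y(1) set_prod_closed[OF As2 subset] by (rule set_mult_assoc)
      also have "Y <#> set_prod G As2 N = set_prod G As2 (Y <#> N)"
        by (rule set_prod_central_mod[OF N Y(1,2) As2])
      finally show ?thesis using As(2) by (simp add: As'(1) set_prod_append)
    qed
    ultimately show ?thesis by blast
  qed
qed

lemma nilpotent_factorization:
  assumes fin: "finite (carrier G)" and nil: "nilpotent G" and ord: "order G = prod_list ms"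
  obtains As where "map card As = ms" "\<forall>A\<in>set As. A \<subseteq> carrier G" "set_prod G As {\<one>} = carrier G"
proof -
  obtain As where As: "list_all2 (\<lambda>A m. A \<subseteq> carrier G \<and> card A \<le> m) As ms"
      "set_prod G As {\<one>} = carrier G"
    using nilpotent_cover[OF fin nil one_is_normal, of ms] ord by auto
  have sub: "\<forall>A\<in>set As. A \<subseteq> carrier G"
    using As(1) by (induction rule: list_all2_induct) auto
  then have "\<forall>A\<in>set As. finite A" using fin finite_subset by blast
  then have "prod_list ms \<le> prod_list (map card As)"
    using card_set_prod_le[of As "{\<one>}"] As(2) ord by (simp add: order_def)
  moreover have "list_all2 (\<le>) (map card As) ms"
    using As(1) by (auto simp: list_all2_conv_all_nth)
  moreover have "0 < prod_list ms" using fin ord order_gt_0_iff_finite by simp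
  ultimately have "map card As = ms" by (intro list_eq_if_prod_list_ge)
  then show thesis using that sub As(2) by blast
qed

section \<open>Making the factors disjoint\<close>

lemma card_two_sided_translate:
  assumes "h \<in> carrier G" "t \<in> carrier G" "A \<subseteq> carrier G"
  shows "card ({h} <#> A <#> {t}) = card A"
proof -
  have "{h} <#> A <#> {t} = (\<lambda>a. h \<otimes> a \<otimes> t) ` A" by (auto simp: set_mult_def)
  moreover have "inj_on (\<lambda>a. h \<otimes> a \<otimes> t) A" using assms by (intro inj_onI) (simp add: subset_iff)
  ultimately show ?thesis by (simp add: card_image)
qed

text \<open>Each pair of an element of \<open>F\<close> and an element of \<open>A\<close> excludes exactly one \<open>t\<close>.\<close>
lemma exists_right_translate_disjoint:
  assumes fin: "finite (carrier G)" and A: "A \<subseteq> carrier G" and F: "F \<subseteq> carrier G"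
    and less: "card F * card A < order G"
  obtains t where "t \<in> carrier G" "(A <#> {t}) \<inter> F = {}"
proof -
  let ?bad = "(\<lambda>(f, a). inv a \<otimes> f) ` (F \<times> A)"
  have f: "finite (F \<times> A)" using fin A F finite_subset by blast
  then have "card ?bad < card (carrier G)"
    using card_image_le[of "F \<times> A" "\<lambda>(f, a). inv a \<otimes> f"] less
    by (simp add: card_cartesian_product order_def)
  then have "\<not> carrier G \<subseteq> ?bad" using card_mono[of ?bad "carrier G"] f by auto
  then obtain t where t: "t \<in> carrier G" "t \<notin> ?bad" by blast
  have "a \<otimes> t \<notin> F" if a: "a \<in> A" for a
  proof
    assume "a \<otimes> t \<in> F"
    moreover have "t = inv a \<otimes> (a \<otimes> t)" using a t A by (simp add: m_assoc[symmetric] subset_iff)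
    ultimately show False using t(2) a by (metis (no_types, lifting) SigmaI case_prod_conv imageI)
  qed
  then show thesis using that t(1) by (auto simp: set_mult_def)
qed

lemma exists_left_translate_disjoint:
  assumes fin: "finite (carrier G)" and A: "A \<subseteq> carrier G" and F: "F \<subseteq> carrier G"
    and less: "card F * card A < order G"
  obtains t where "t \<in> carrier G" "({t} <#> A) \<inter> F = {}"
proof -
  let ?bad = "(\<lambda>(f, a). f \<otimes> inv a) ` (F \<times> A)"
  have f: "finite (F \<times> A)" using fin A F finite_subset by blast
  then have "card ?bad < card (carrier G)"
    using card_image_le[of "F \<times> A" "\<lambda>(f, a). f \<otimes> inv a"] less
    by (simp add: card_cartesian_product order_def)
  then have "\<not> carrier G \<subseteq> ?bad" using card_mono[of ?bad "carrier G"] f by auto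
  then obtain t where t: "t \<in> carrier G" "t \<notin> ?bad" by blast
  have "t \<otimes> a \<notin> F" if a: "a \<in> A" for a
  proof
    assume "t \<otimes> a \<in> F"
    moreover have "t = (t \<otimes> a) \<otimes> inv a" using a t A by (simp add: m_assoc subset_iff)
    ultimately show False using t(2) a by (metis (no_types, lifting) SigmaI case_prod_conv imageI)
  qed
  then show thesis using that t(1) by (auto simp: set_mult_def)
qed

lemma translate_carrier:
  assumes "h \<in> carrier G" "g \<in> carrier G"
  shows "{h} <#> carrier G <#> {g} = carrier G"
proof
  show "carrier G \<subseteq> {h} <#> carrier G <#> {g}"
  proof
    fix y assume y: "y \<in> carrier G"
    then have "y = h \<otimes> (inv h \<otimes> y \<otimes> inv g) \<otimes> g"
      using assms by (simp add: m_assoc) (simp add: m_assoc[symmetric])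
    moreover have "inv h \<otimes> y \<otimes> inv g \<in> carrier G" using y assms by simp
    ultimately show "y \<in> {h} <#> carrier G <#> {g}" unfolding set_mult_def by blast
  qed
qed (use assms in \<open>intro setmult_subset_G; simp\<close>)

text \<open>Between neighbouring factors one may insert \<open>t\<close> and its inverse, so every factor can be translated
  on the right away from the earlier ones if the next factor absorbs the inverse on its left; the last
  translation \<open>g\<close> remains in the product. The set \<open>F\<close> collects what the factors already chosen occupy,
  and \<open>h\<close> is the inverse that they pass on.\<close>
lemma disjoint_translates:
  assumes fin: "finite (carrier G)"
  shows "h \<in> carrier G \<Longrightarrow> F \<subseteq> carrier G \<Longrightarrow> \<forall>A\<in>set As. A \<subseteq> carrier G \<Longrightarrow>
    \<forall>j<length As. (card F + sum_list (take j (map card As))) * card (As ! j) < order G \<Longrightarrow>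
    \<exists>Bs g. g \<in> carrier G \<and> map card Bs = map card As \<and>
      (\<forall>B\<in>set Bs. B \<subseteq> carrier G \<and> B \<inter> F = {}) \<and> sorted_wrt (\<lambda>A B. A \<inter> B = {}) Bs \<and>
      set_prod G Bs {\<one>} = {h} <#> set_prod G As {\<one>} <#> {g}"
proof (induction As arbitrary: h F)
  case Nil
  then show ?case by (intro exI[of _ "[]"] exI[of _ "inv h"]) (auto simp: set_mult_def)
next
  case (Cons A As)
  note h = Cons.prems(1) and F = Cons.prems(2)
  have A: "A \<subseteq> carrier G" and As: "\<forall>A\<in>set As. A \<subseteq> carrier G" using Cons.prems by auto
  have hA: "{h} <#> A \<subseteq> carrier G" using h A by (intro setmult_subset_G) auto
  have "card ({h} <#> A) = card A"
  proof -
    have "{h} <#> A <#> {\<one>} = {h} <#> A" using hA by (rule set_mult_one)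
    then show ?thesis using card_two_sided_translate[OF h one_closed A] by simp
  qed
  then have "card F * card ({h} <#> A) < order G" using Cons.prems(4) by force
  then obtain t where t: "t \<in> carrier G" "({h} <#> A <#> {t}) \<inter> F = {}"
    by (rule exists_right_translate_disjoint[OF fin hA F])
  define B where "B = {h} <#> A <#> {t}"
  have B: "B \<subseteq> carrier G" using setmult_subset_G[OF hA, of "{t}"] t(1) by (simp add: B_def)
  have cB: "card B = card A" unfolding B_def by (rule card_two_sided_translate[OF h t(1) A])
  have "\<forall>j<length As. (card (F \<union> B) + sum_list (take j (map card As))) * card (As ! j) < order G"
  proof (intro allI impI)
    fix j assume "j < length As"
    then have *: "(card F + (card A + sum_list (take j (map card As)))) * card (As ! j) < order G"
      using Cons.prems(4) by (auto dest: spec[of _ "Suc j"])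
    have "(card (F \<union> B) + sum_list (take j (map card As))) * card (As ! j) \<le>
        (card F + (card A + sum_list (take j (map card As)))) * card (As ! j)"
      using card_Un_le[of F B] cB by (intro mult_le_mono1) simp
    then show "(card (F \<union> B) + sum_list (take j (map card As))) * card (As ! j) < order G"
      using * by (rule le_less_trans)
  qed
  from Cons.IH[OF inv_closed[OF t(1)] Un_least[OF F B] As this] obtain Bs g where Bs: "g \<in> carrier G"
    "map card Bs = map card As" "\<forall>B'\<in>set Bs. B' \<subseteq> carrier G \<and> B' \<inter> (F \<union> B) = {}"
    "sorted_wrt (\<lambda>A B. A \<inter> B = {}) Bs"
    "set_prod G Bs {\<one>} = {inv t} <#> set_prod G As {\<one>} <#> {g}"
    by blast
  let ?P = "set_prod G As {\<one>}"
  have P: "?P \<subseteq> carrier G" using As by (intro set_prod_closed) auto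
  have "set_prod G (B # Bs) {\<one>} = {h} <#> (A <#> (({t} <#> {inv t}) <#> (?P <#> {g})))"
    using h t(1) A P Bs(1) by (simp add: Bs(5) B_def set_mult_assoc setmult_subset_G)
  \<comment> \<open>The translation of \<open>A\<close> cancels against the one passed on to the rest.\<close>
  also have "{t} <#> {inv t} = {\<one>}" using t(1) by (simp add: set_mult_def)
  also have "{\<one>} <#> (?P <#> {g}) = ?P <#> {g}"
    using setmult_subset_G[OF P, of "{g}"] Bs(1) by (intro set_mult_one) simp
  also have "{h} <#> (A <#> (?P <#> {g})) = {h} <#> set_prod G (A # As) {\<one>} <#> {g}"
    using h A P Bs(1) by (simp add: set_mult_assoc setmult_subset_G)
  finally have "set_prod G (B # Bs) {\<one>} = {h} <#> set_prod G (A # As) {\<one>} <#> {g}" .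
  moreover have "B \<inter> F = {}" using t(2) by (simp add: B_def)
  ultimately show ?case using Bs B cB
    by (intro exI[of _ "B # Bs"] exI[of _ g]) auto
qed

section \<open>The sizes 2, 2, m\<close>

text \<open>With sizes \<open>2, 2, 2\<close> the bound on excluded translations equals the group order, so the factors are
  written down explicitly. A central \<open>z\<close> of order \<open>2\<close> and a product covering the group modulo \<open>{\<one>, z}\<close>,
  normalized so that both factors contain \<open>\<one>\<close>, give eight distinct elements \<open>u \<otimes> v \<otimes> m\<close> with
  \<open>u \<in> {\<one>, a}\<close>, \<open>v \<in> {\<one>, b}\<close> and \<open>m \<in> {\<one>, z}\<close>. The factor \<open>{\<one>, a}\<close>, the translate of \<open>{\<one>, b}\<close> by \<open>z\<close>
  and the translate of \<open>{\<one>, z}\<close> by \<open>a \<otimes> b\<close> use six of these elements, each once.\<close>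
lemma order_eight_complete_factorization:
  assumes fin: "finite (carrier G)" and nil: "nilpotent G" and ord: "order G = 8"
  shows "\<exists>As. map card As = [2, 2, 2] \<and> complete_factorization G As"
proof -
  have "{\<one>} \<noteq> carrier G"
  proof
    assume "{\<one>} = carrier G"
    from arg_cong[OF this, of card] show False using ord by (simp add: order_def)
  qed
  then obtain z and q :: nat where z: "z \<in> carrier G" "z \<notin> {\<one>}" "central_mod G {\<one>} z"
    and q: "Factorial_Ring.prime q" "z [^] q \<in> {\<one>}"
    by (rule nilpotent_central_mod_prime[OF fin nil one_is_normal])
  have comm: "z \<otimes> g = g \<otimes> z" if "g \<in> carrier G" for g
    using z that by (auto simp: central_mod_def)
  have M: "(\<lambda>j. z [^] j) ` {..<q} <#> {\<one>} \<lhd> G" "card ((\<lambda>j. z [^] j) ` {..<q} <#> {\<one>}) = q"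
    using central_extension[OF fin one_is_normal z q] by simp_all
  have "q dvd 2 ^ 3"
    using lagrange[OF normal_imp_subgroup[OF M(1)]] M(2) ord by (simp add: dvd_def) (metis mult.commute)
  then have "q = 2"
    using q(1) by (metis prime_dvd_power primes_dvd_imp_eq two_is_prime_nat)
  then have Z: "(\<lambda>j. z [^] j) ` {..<q} <#> {\<one>} = {\<one>, z}"
    using z(1) by (auto simp: set_mult_def lessThan_nat_numeral lessThan_Suc numeral_2_eq_2)
  have zz: "z \<otimes> z = \<one>" using q(2) z(1) \<open>q = 2\<close> by (simp add: numeral_2_eq_2)
  obtain A B where AB: "A \<subseteq> carrier G" "card A \<le> 2" "B \<subseteq> carrier G" "card B \<le> 2"
      "A <#> (B <#> {\<one>, z}) = carrier G"
  proof -
    have "prod_list [2, 2] * card {\<one>, z} = order G" using z(2) ord by simp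
    from nilpotent_cover[OF fin nil M(1)[unfolded Z] this]
    show thesis using that by (auto simp: list_all2_Cons2)
  qed
  have pair: "\<exists>x y. C = {x, y}" if "C \<subseteq> carrier G" "card C \<le> 2" "C \<noteq> {}" for C
  proof -
    have "finite C" using that fin finite_subset by blast
    then have "card C = 1 \<or> card C = 2" using that by (auto simp: le_Suc_eq numeral_2_eq_2)
    then show ?thesis by (auto simp: card_1_singleton_iff card_2_iff)
  qed
  have "A \<noteq> {}" "B \<noteq> {}" using AB(5) one_closed by (auto simp: set_mult_def)
  \<comment> \<open>Only the bound \<open>2\<close> on the sizes is known here; that \<open>a1\<close> and \<open>a2\<close> differ comes out of the count below.\<close>
  then obtain a1 a2 b1 b2 where ab: "A = {a1, a2}" "B = {b1, b2}"
    using pair AB by metis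
  have c: "a1 \<in> carrier G" "a2 \<in> carrier G" "b1 \<in> carrier G" "b2 \<in> carrier G"
    using AB ab by auto
  define a b where "a = inv a1 \<otimes> a2" and "b = b2 \<otimes> inv b1"
  have abG: "a \<in> carrier G" "b \<in> carrier G" using c by (auto simp: a_def b_def)
  have rep: "\<exists>u\<in>{\<one>, a}. \<exists>v\<in>{\<one>, b}. \<exists>m\<in>{\<one>, z}. g = u \<otimes> v \<otimes> m" if g: "g \<in> carrier G" for g
  proof -
    have "a1 \<otimes> g \<otimes> b1 \<in> A <#> (B <#> {\<one>, z})" using AB(5) g c by simp
    then obtain a' b' m where e: "a' \<in> A" "b' \<in> B" "m \<in> {\<one>, z}" "a1 \<otimes> g \<otimes> b1 = a' \<otimes> (b' \<otimes> m)"
      unfolding set_mult_def by blast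
    have c': "a' \<in> carrier G" "b' \<in> carrier G" "m \<in> carrier G" using e z AB by auto
    have mb: "m \<otimes> inv b1 = inv b1 \<otimes> m" using e(3) comm c by auto
    have "g = inv a1 \<otimes> (a1 \<otimes> g \<otimes> b1) \<otimes> inv b1"
    proof -
      have "a1 \<otimes> g \<otimes> b1 \<otimes> inv b1 = a1 \<otimes> g" using c g by (simp add: m_assoc)
      moreover have "inv a1 \<otimes> (a1 \<otimes> g) = g" using c g by (simp add: m_assoc[symmetric])
      ultimately show ?thesis using c g by (simp add: m_assoc)
    qed
    also have "\<dots> = inv a1 \<otimes> a' \<otimes> (b' \<otimes> (m \<otimes> inv b1))"
      unfolding e(4) using c c' by (simp add: m_assoc)
    also have "\<dots> = (inv a1 \<otimes> a') \<otimes> (b' \<otimes> inv b1) \<otimes> m"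
      unfolding mb using c c' by (simp add: m_assoc)
    finally have "g = (inv a1 \<otimes> a') \<otimes> (b' \<otimes> inv b1) \<otimes> m" .
    moreover have "inv a1 \<otimes> a' \<in> {\<one>, a}" "b' \<otimes> inv b1 \<in> {\<one>, b}"
      using e c by (auto simp: ab a_def b_def)
    ultimately show ?thesis using e(3) by blast
  qed
  let ?L = "[\<one>, a, b, a \<otimes> b, z, a \<otimes> z, b \<otimes> z, a \<otimes> b \<otimes> z]"
  have "carrier G = set ?L"
  proof
    show "carrier G \<subseteq> set ?L"
    proof
      fix g assume "g \<in> carrier G"
      from rep[OF this] show "g \<in> set ?L" using abG z(1) by auto
    qed
    show "set ?L \<subseteq> carrier G" using abG z(1) by auto
  qed
  \<comment> \<open>Eight expressions cover eight elements, so no two of them agree.\<close>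
  then have "card (set ?L) = length ?L" using ord by (simp add: order_def)
  then have dist: "distinct ?L" by (rule card_distinct)
  let ?Bs = "[{\<one>, a}, {z, b \<otimes> z}, {a \<otimes> b, a \<otimes> b \<otimes> z}]"
  have sub: "\<forall>B\<in>set ?Bs. B \<subseteq> carrier G" using abG z(1) by auto
  have cards: "map card ?Bs = [2, 2, 2]" using dist by auto
  have "complete_factorization G ?Bs"
  proof (rule complete_factorizationI[OF fin sub])
    show "sorted_wrt (\<lambda>A B. A \<inter> B = {}) ?Bs" using dist by auto
    show "prod_list (map card ?Bs) = order G" unfolding cards using ord by simp
    show "set_prod G ?Bs {\<one>} = carrier G"
    proof
      show "set_prod G ?Bs {\<one>} \<subseteq> carrier G" using sub by (intro set_prod_closed) auto
      show "carrier G \<subseteq> set_prod G ?Bs {\<one>}"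
      proof
        fix g assume g: "g \<in> carrier G"
        let ?w = "a \<otimes> b"
        have w: "?w \<in> carrier G" using abG by simp
        obtain u v m where e: "u \<in> {\<one>, a}" "v \<in> {\<one>, b}" "m \<in> {\<one>, z}"
          "g \<otimes> inv ?w = u \<otimes> v \<otimes> m"
          using rep[of "g \<otimes> inv ?w"] g w by (meson inv_closed m_closed)
        have c': "u \<in> carrier G" "v \<in> carrier G" "m \<in> carrier G" using e(1-3) z(1) abG by auto
        have "g = g \<otimes> inv ?w \<otimes> ?w" using g w by (simp add: m_assoc)
        also have "\<dots> = u \<otimes> (v \<otimes> (m \<otimes> ?w))" unfolding e(4) using c' w by (simp add: m_assoc)
        also have "m \<otimes> ?w = z \<otimes> (?w \<otimes> (z \<otimes> m))"
        proof -
          have "z \<otimes> (?w \<otimes> (z \<otimes> m)) = (z \<otimes> ?w) \<otimes> z \<otimes> m" using w z(1) c' by (simp add: m_assoc)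
          also have "\<dots> = ?w \<otimes> (z \<otimes> z) \<otimes> m" unfolding comm[OF w] using w z(1) c' by (simp add: m_assoc)
          also have "\<dots> = m \<otimes> ?w" using e(3) comm[OF w] w zz by auto
          finally show ?thesis ..
        qed
        finally have "g = u \<otimes> ((v \<otimes> z) \<otimes> ((?w \<otimes> (z \<otimes> m)) \<otimes> \<one>))"
          using c' w z(1) by (simp add: m_assoc)
        moreover have "v \<otimes> z \<in> {z, b \<otimes> z}" using e(2) z(1) by auto
        moreover have "?w \<otimes> (z \<otimes> m) \<in> {?w, ?w \<otimes> z}" using e(3) z(1) zz w by auto
        moreover have mem: "p \<otimes> r \<in> P <#> R" if "p \<in> P" "r \<in> R" for p r P R
          using that by (auto simp: set_mult_def)
        ultimately show "g \<in> set_prod G ?Bs {\<one>}"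
          using e(1) by (simp only: set_prod_simps) (intro mem singletonI)
      qed
    qed
  qed
  then show ?thesis using cards by (intro exI[of _ ?Bs] conjI)
qed

text \<open>Placing the last factor after two factors of size \<open>2\<close> may fail for want of room, but the order of
  the choices is free: the second and third factors are made disjoint first, and then the first one,
  whose left side is unconstrained, is translated on the left. This needs \<open>(2 + m) * 2 < 4 * m\<close>.\<close>
lemma two_two_complete_factorization:
  assumes fin: "finite (carrier G)" and nil: "nilpotent G" and ord: "order G = 4 * m" and m: "2 < m"
  shows "\<exists>As. map card As = [2, 2, m] \<and> complete_factorization G As"
proof -
  obtain As where As: "map card As = [2, 2, m]" "\<forall>A\<in>set As. A \<subseteq> carrier G" "set_prod G As {\<one>} = carrier G"
    using nilpotent_factorization[OF fin nil, of "[2, 2, m]"] ord by auto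
  then obtain A1 A2 A3 where A: "As = [A1, A2, A3]" by (auto simp: map_eq_Cons_conv)
  have A1: "A1 \<subseteq> carrier G" using As A by simp
  have card: "card A1 = 2" "card A2 = 2" "card A3 = m" using As A by auto
  have room: "\<forall>j<length [A2, A3]. 
      (card ({} :: 'a set) + sum_list (take j (map card [A2, A3]))) * card ([A2, A3] ! j) < order G"
    using m ord card by (auto simp: less_Suc_eq)
  have sub23: "\<forall>A\<in>set [A2, A3]. A \<subseteq> carrier G" using As(2) A by simp
  obtain Bs g where Bs: "g \<in> carrier G" "map card Bs = map card [A2, A3]" 
      "\<forall>B\<in>set Bs. B \<subseteq> carrier G" "sorted_wrt (\<lambda>A B. A \<inter> B = {}) Bs"
      "set_prod G Bs {\<one>} = {\<one>} <#> set_prod G [A2, A3] {\<one>} <#> {g}"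
    using disjoint_translates[OF fin one_closed empty_subsetI sub23 room] by (elim exE conjE) (rule that; simp)
  then obtain B2 B3 where B: "Bs = [B2, B3]" by (auto simp: map_eq_Cons_conv)
  have "card (B2 \<union> B3) * card A1 < order G"
    using card_Un_le[of B2 B3] Bs(2) B card ord m by auto
  moreover have "B2 \<union> B3 \<subseteq> carrier G" using Bs(3) B by simp
  ultimately obtain t where t: "t \<in> carrier G" "({t} <#> A1) \<inter> (B2 \<union> B3) = {}"
    using exists_left_translate_disjoint[OF fin A1] by metis
  let ?Bs = "[{t} <#> A1, B2, B3]"
  have sub: "\<forall>B\<in>set ?Bs. B \<subseteq> carrier G" using Bs(3) B setmult_subset_G[of "{t}" A1] t(1) A1 by simp
  have "{t} <#> A1 <#> {\<one>} = {t} <#> A1" using sub by (intro set_mult_one) simp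
  then have cards: "map card ?Bs = [2, 2, m]"
    using card_two_sided_translate[OF t(1) one_closed A1] card Bs(2) B by simp
  have "complete_factorization G ?Bs"
  proof (rule complete_factorizationI[OF fin sub])
    show "sorted_wrt (\<lambda>A B. A \<inter> B = {}) ?Bs" using t(2) Bs(4) B by auto
    show "prod_list (map card ?Bs) = order G" unfolding cards using ord by simp
    let ?P = "set_prod G [A2, A3] {\<one>}"
    have P: "?P \<subseteq> carrier G" using As(2) A by (intro set_prod_closed) auto
    have "{\<one>} <#> ?P = ?P" using P by (rule set_mult_one)
    then have "set_prod G ?Bs {\<one>} = {t} <#> A1 <#> (?P <#> {g})"
      using Bs(5) B by simp
    also have "\<dots> = {t} <#> (A1 <#> ?P) <#> {g}"
      using t(1) A1 P Bs(1) by (simp add: set_mult_assoc setmult_subset_G)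
    also have "A1 <#> ?P = carrier G" using As(3) A by simp
    finally show "set_prod G ?Bs {\<one>} = carrier G" using translate_carrier t(1) Bs(1) by simp
  qed
  then show ?thesis using cards by (intro exI[of _ ?Bs] conjI)
qed

end

section \<open>Complete factorizations of nilpotent groups\<close>

theorem mainTheorem1:
  fixes G :: "('a, 'b) monoid_scheme" and ms :: "nat list"
  assumes "group G" and "finite (carrier G)" and "nilpotent G"
    and "order G = prod_list ms"
    and "\<forall>i<length ms. ms ! i > 1"
    and "length ms \<ge> 3"
  shows "\<exists>As. length As = length ms \<and> complete_factorization G As \<and>
           (\<forall>i<length ms. card (As ! i) = ms ! i)"
proof -
  interpret group G by (rule assms(1))
  have gt: "\<forall>m\<in>set ms. 1 < m" using assms(5) by (auto simp: in_set_conv_nth)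
  have "\<exists>As. map card As = ms \<and> complete_factorization G As"
  proof (cases "\<exists>m. ms = [2, 2, m]")
    case True
    then obtain m where m: "ms = [2, 2, m]" by blast
    show ?thesis
    proof (cases "m = 2")
      case True
      then show ?thesis using order_eight_complete_factorization assms(2-4) m by simp
    next
      case False
      then have "2 < m" using gt m by simp
      then show ?thesis using two_two_complete_factorization assms(2-4) m by simp
    qed
  next
    case False
    obtain As where As: "map card As = ms" "\<forall>A\<in>set As. A \<subseteq> carrier G" "set_prod G As {\<one>\<^bsub>G\<^esub>} = carrier G"
      by (rule nilpotent_factorization[OF assms(2-4)])
    have "\<forall>j<length As. (card {} + sum_list (take j (map card As))) * card (As ! j) < order G"
    proof (intro allI impI)
      fix j assume "j < length As"
      then have j: "j < length ms" "card (As ! j) = ms ! j" unfolding As(1)[symmetric] by auto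
      show "(card {} + sum_list (take j (map card As))) * card (As ! j) < order G"
        using sum_take_mult_less_prod_list[OF gt assms(6) False j(1)] 
        by (simp add: As(1) j(2) assms(4))
    qed
    with disjoint_translates[OF assms(2) one_closed _ As(2), of "{}"] obtain Bs g where
      Bs: "g \<in> carrier G" "map card Bs = ms" "\<forall>B\<in>set Bs. B \<subseteq> carrier G"
        "sorted_wrt (\<lambda>A B. A \<inter> B = {}) Bs"
        "set_prod G Bs {\<one>\<^bsub>G\<^esub>} = {\<one>\<^bsub>G\<^esub>} <#>\<^bsub>G\<^esub> carrier G <#>\<^bsub>G\<^esub> {g}"
      by (auto simp: As(1,3))
    have "complete_factorization G Bs"
      using Bs assms(2,4) translate_carrier by (intro complete_factorizationI) auto
    then show ?thesis using Bs(2) by blast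
  qed
  then obtain As where "map card As = ms" "complete_factorization G As" by blast
  then show ?thesis by (metis length_map nth_map)
qed

end
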